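(* Let $(E_{10},E_{01},E_{11},L)\in\mathbb{Q}^4$ satisfy $$4E_{11}^2+E_{10}^4+E_{01}^4-2E_{10}^2E_{01}^2-2L^2E_{10}^2-6E_{01}^2L^2+L^4=0$$ with $E_{10}^2+E_{01}^2\neq 0$. Then there exist a positive integer $\alpha$ and an integer point $(E'_{10},E'_{20},E'_{30},E'_{01},E'_{02},E'_{03},E'_{21},E'_{11},E'_{12},L')\in\mathbb{Z}^{10}$ with $E'_{10}=\alpha E_{10}$, $E'_{01}=\alpha E_{01}$, $E'_{11}=\alpha^2E_{11}$, $L'=\alpha L$, which satisfies the complete system of equations (with the primed variables in place of the unprimed ones) $$E_{10}^2-2E_{20}-L^2=0,\qquad 2E_{02}-4E_{20}-E_{01}^2+2E_{10}^2=0,$$ $$E_{10}E_{11}-3E_{03}-E_{21}+3E_{01}E_{02}-E_{20}E_{01}-E_{01}^3=0,$$ $$E_{01}E_{11}-E_{12}-3E_{30}+E_{10}E_{02}+E_{20}E_{10}-E_{01}^2E_{10}=0,$$ $$-E_{10}E_{21}-E_{01}E_{12}-E_{01}E_{30}-E_{01}^3E_{10}+E_{01}^2E_{11}-E_{02}E_{11}+E_{11}E_{20}-E_{10}E_{03}+2E_{10}E_{01}E_{02}=0,$$ $$4E_{01}E_{10}E_{11}-3E_{01}^2E_{10}^2+2E_{10}^2E_{02}+2E_{20}E_{01}^2-2E_{10}E_{12}-2E_{02}E_{20}-2E_{01}E_{21}-E_{11}^2-12E_{10}E_{30}+6E_{20}^2=0,$$ $$4E_{01}E_{10}E_{11}-4E_{10}^2E_{02}-4E_{20}E_{01}^2-2E_{10}E_{12}+10E_{02}E_{20}-2E_{01}E_{21}-E_{11}^2-12E_{01}E_{03}-3E_{01}^4-6E_{02}^2+12E_{01}^2E_{02}=0,$$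 $$\begin{aligned}&9E_{01}E_{03}E_{20}-7E_{01}^2E_{02}E_{20}+2E_{02}E_{10}E_{12}-2E_{01}^2E_{10}E_{12}+3E_{03}E_{10}E_{11}+4E_{01}^3E_{10}E_{11}\\&-7E_{01}E_{02}E_{10}E_{11}-6E_{01}E_{03}E_{10}^2+8E_{01}^2E_{02}E_{10}^2+3E_{01}E_{11}E_{30}-2E_{01}E_{20}E_{21}+E_{10}E_{12}E_{20}\\&-E_{02}E_{10}^2E_{20}+E_{01}E_{10}E_{11}E_{20}+9E_{02}E_{10}E_{30}-2E_{02}E_{20}^2+2E_{01}^2E_{20}^2-E_{11}^2E_{20}-3E_{12}E_{30}\\&+E_{02}E_{11}^2-E_{01}^2E_{11}^2-2E_{02}^2E_{10}^2+2E_{01}^4E_{20}+2E_{02}^2E_{20}-3E_{03}E_{21}-2E_{01}^3E_{21}\\&+5E_{01}E_{02}E_{21}-6E_{01}^2E_{10}E_{30}-3E_{01}^4E_{10}^2=0,\end{aligned}$$ and $q=0$ for every $q\in K$.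
   Context: Let $\varphi:\mathbb{Q}[E_{10},E_{20},E_{30},E_{01},E_{02},E_{03},E_{21},E_{11},E_{12},L]\to\mathbb{Q}[x_1,x_2,x_3,d_1,d_2,d_3,L]$ be the ring homomorphism fixing $L$ and sending $E_{10}\mapsto x_1+x_2+x_3$, $E_{20}\mapsto x_1x_2+x_2x_3+x_3x_1$, $E_{30}\mapsto x_1x_2x_3$, $E_{01}\mapsto d_1+d_2+d_3$, $E_{02}\mapsto d_1d_2+d_2d_3+d_3d_1$, $E_{03}\mapsto d_1d_2d_3$, $E_{21}\mapsto x_1x_2d_3+x_2x_3d_1+x_3x_1d_2$, $E_{11}\mapsto x_1d_2+d_1x_2+x_2d_3+d_2x_3+x_3d_1+d_3x_1$, $E_{12}\mapsto x_1d_2d_3+x_2d_3d_1+x_3d_1d_2$, and let $K=\ker\varphi$ (the "kernel equations" are $q=0$ for $q\in K$). *)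

theory Defs
  imports Complex_Main "HOL-Library.Poly_Mapping"
begin

text \<open>
  Polynomials over \<open>\<rat>\<close> in the variables of type \<open>'v\<close> are finitely supported functions from monomials
  (finitely supported exponent vectors) to coefficients; the ring structure is the convolution
  product of \<^theory>\<open>HOL-Library.Poly_Mapping\<close>.
\<close>

type_synonym 'v qpoly = "('v \<Rightarrow>\<^sub>0 nat) \<Rightarrow>\<^sub>0 rat"

definition Const :: "rat \<Rightarrow> 'v qpoly" where
  "Const a = Poly_Mapping.single 0 a"

definition Var :: "'v \<Rightarrow> 'v qpoly" where
  "Var v = Poly_Mapping.single (Poly_Mapping.single v 1) 1"

definition monom_subst :: "('v \<Rightarrow> 'b::comm_semiring_1) \<Rightarrow> ('v \<Rightarrow>\<^sub>0 nat) \<Rightarrow> 'b" where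
  "monom_subst f m = (\<Prod>v\<in>Poly_Mapping.keys m. f v ^ Poly_Mapping.lookup m v)"

text \<open>
  \<open>poly_subst c f\<close> maps each coefficient by \<open>c\<close> and each variable by \<open>f\<close>. If \<open>c\<close> is a ring
  homomorphism, this is the unique ring homomorphism extending \<open>c\<close> and \<open>f\<close>
  (\<open>poly_subst_add\<close>, \<open>poly_subst_mult\<close>, \<open>poly_subst_Const\<close>, \<open>poly_subst_Var\<close> below).
\<close>

definition poly_subst :: "(rat \<Rightarrow> 'b) \<Rightarrow> ('v \<Rightarrow> 'b::comm_semiring_1) \<Rightarrow> 'v qpoly \<Rightarrow> 'b" where
  "poly_subst c f p =
     (\<Sum>m\<in>Poly_Mapping.keys p. c (Poly_Mapping.lookup p m) * monom_subst f m)"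

abbreviation poly_eval :: "('v \<Rightarrow> rat) \<Rightarrow> 'v qpoly \<Rightarrow> rat" where
  "poly_eval \<equiv> poly_subst (\<lambda>a. a)"

datatype evar = E10 | E20 | E30 | E01 | E02 | E03 | E21 | E11 | E12 | EL

datatype xvar = X1 | X2 | X3 | D1 | D2 | D3 | XL

text \<open>\<open>EL\<close> and \<open>XL\<close> both stand for the variable \<open>L\<close>, which \<open>phi\<close> fixes.\<close>

fun phi_var :: "evar \<Rightarrow> xvar qpoly" where
  "phi_var E10 = Var X1 + Var X2 + Var X3"
| "phi_var E20 = Var X1 * Var X2 + Var X2 * Var X3 + Var X3 * Var X1"
| "phi_var E30 = Var X1 * Var X2 * Var X3"
| "phi_var E01 = Var D1 + Var D2 + Var D3"
| "phi_var E02 = Var D1 * Var D2 + Var D2 * Var D3 + Var D3 * Var D1"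
| "phi_var E03 = Var D1 * Var D2 * Var D3"
| "phi_var E21 = Var X1 * Var X2 * Var D3 + Var X2 * Var X3 * Var D1 + Var X3 * Var X1 * Var D2"
| "phi_var E11 = Var X1 * Var D2 + Var D1 * Var X2 + Var X2 * Var D3 + Var D2 * Var X3
                 + Var X3 * Var D1 + Var D3 * Var X1"
| "phi_var E12 = Var X1 * Var D2 * Var D3 + Var X2 * Var D3 * Var D1 + Var X3 * Var D1 * Var D2"
| "phi_var EL = Var XL"

definition phi :: "evar qpoly \<Rightarrow> xvar qpoly" where
  "phi = poly_subst Const phi_var"

definition K :: "evar qpoly set" where
  "K = {q. phi q = 0}"

fun int_point ::
  "int \<Rightarrow> int \<Rightarrow> int \<Rightarrow> int \<Rightarrow> int \<Rightarrow> int \<Rightarrow> int \<Rightarrow> int \<Rightarrow> int \<Rightarrow> int \<Rightarrow> evar \<Rightarrow> rat" where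
  "int_point e10 e20 e30 e01 e02 e03 e21 e11 e12 l E10 = of_int e10"
| "int_point e10 e20 e30 e01 e02 e03 e21 e11 e12 l E20 = of_int e20"
| "int_point e10 e20 e30 e01 e02 e03 e21 e11 e12 l E30 = of_int e30"
| "int_point e10 e20 e30 e01 e02 e03 e21 e11 e12 l E01 = of_int e01"
| "int_point e10 e20 e30 e01 e02 e03 e21 e11 e12 l E02 = of_int e02"
| "int_point e10 e20 e30 e01 e02 e03 e21 e11 e12 l E03 = of_int e03"
| "int_point e10 e20 e30 e01 e02 e03 e21 e11 e12 l E21 = of_int e21"
| "int_point e10 e20 e30 e01 e02 e03 e21 e11 e12 l E11 = of_int e11"
| "int_point e10 e20 e30 e01 e02 e03 e21 e11 e12 l E12 = of_int e12"
| "int_point e10 e20 e30 e01 e02 e03 e21 e11 e12 l EL = of_int l"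

lemma monom_subst_superset:
  assumes "finite S" "Poly_Mapping.keys m \<subseteq> S"
  shows "monom_subst f m = (\<Prod>v\<in>S. f v ^ Poly_Mapping.lookup m v)"
  unfolding monom_subst_def
  by (rule prod.mono_neutral_left) (use assms in \<open>auto simp: in_keys_iff\<close>)

lemma monom_subst_add: "monom_subst f (m + n) = monom_subst f m * monom_subst f n"
proof -
  let ?S = "Poly_Mapping.keys m \<union> Poly_Mapping.keys n"
  have "monom_subst f (m + n) = (\<Prod>v\<in>?S. f v ^ Poly_Mapping.lookup (m + n) v)"
    by (rule monom_subst_superset) (auto simp: Poly_Mapping.keys_add)
  moreover have "monom_subst f m = (\<Prod>v\<in>?S. f v ^ Poly_Mapping.lookup m v)"
    by (rule monom_subst_superset) auto
  moreover have "monom_subst f n = (\<Prod>v\<in>?S. f v ^ Poly_Mapping.lookup n v)"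
    by (rule monom_subst_superset) auto
  ultimately show ?thesis
    by (simp add: lookup_add power_add prod.distrib)
qed

lemma poly_subst_superset:
  assumes "c 0 = 0" "finite S" "Poly_Mapping.keys p \<subseteq> S"
  shows "poly_subst c f p = (\<Sum>m\<in>S. c (Poly_Mapping.lookup p m) * monom_subst f m)"
  unfolding poly_subst_def
  by (rule sum.mono_neutral_left) (use assms in \<open>auto simp: in_keys_iff\<close>)

lemma poly_subst_0 [simp]: "poly_subst c f 0 = 0"
  by (simp add: poly_subst_def)

lemma poly_subst_single:
  assumes "c 0 = 0"
  shows "poly_subst c f (Poly_Mapping.single m a) = c a * monom_subst f m"
  using assms by (simp add: poly_subst_def)

lemma poly_subst_Const: "c 0 = 0 \<Longrightarrow> poly_subst c f (Const a) = c a"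
  by (simp add: Const_def poly_subst_single monom_subst_def)

lemma poly_subst_Var: "c 0 = 0 \<Longrightarrow> c 1 = 1 \<Longrightarrow> poly_subst c f (Var v) = f v"
  by (simp add: Var_def poly_subst_single monom_subst_def)

lemma poly_subst_add:
  assumes "c 0 = 0" "\<And>a b. c (a + b) = c a + c b"
  shows "poly_subst c f (p + q) = poly_subst c f p + poly_subst c f q"
proof -
  let ?S = "Poly_Mapping.keys p \<union> Poly_Mapping.keys q"
  have "poly_subst c f (p + q) = (\<Sum>m\<in>?S. c (Poly_Mapping.lookup (p + q) m) * monom_subst f m)"
    by (rule poly_subst_superset) (auto simp: assms(1) Poly_Mapping.keys_add)
  moreover have "poly_subst c f p = (\<Sum>m\<in>?S. c (Poly_Mapping.lookup p m) * monom_subst f m)"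
    by (rule poly_subst_superset) (auto simp: assms(1))
  moreover have "poly_subst c f q = (\<Sum>m\<in>?S. c (Poly_Mapping.lookup q m) * monom_subst f m)"
    by (rule poly_subst_superset) (auto simp: assms(1))
  ultimately show ?thesis
    by (simp add: lookup_add assms(2) distrib_right sum.distrib)
qed

lemma poly_subst_sum:
  assumes "c 0 = 0" "\<And>a b. c (a + b) = c a + c b"
  shows "poly_subst c f (sum g A) = (\<Sum>x\<in>A. poly_subst c f (g x))"
  by (induction A rule: infinite_finite_induct) (auto simp: poly_subst_add[OF assms])

lemma qpoly_expansion:
  fixes p :: "'v qpoly"
  shows "p = (\<Sum>m\<in>Poly_Mapping.keys p. Poly_Mapping.single m (Poly_Mapping.lookup p m))"
proof (rule poly_mapping_eqI)
  fix k
  have "(\<Sum>m\<in>Poly_Mapping.keys p. Poly_Mapping.lookup (Poly_Mapping.single m (Poly_Mapping.lookup p m)) k)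
        = (\<Sum>m\<in>Poly_Mapping.keys p. if m = k then Poly_Mapping.lookup p k else 0)"
    by (rule sum.cong) (auto simp: lookup_single when_def)
  also have "\<dots> = Poly_Mapping.lookup p k"
    by (simp add: in_keys_iff)
  finally show "Poly_Mapping.lookup p k =
      Poly_Mapping.lookup (\<Sum>m\<in>Poly_Mapping.keys p. Poly_Mapping.single m (Poly_Mapping.lookup p m)) k"
    by (simp add: lookup_sum)
qed

lemma poly_subst_mult:
  assumes c: "c 0 = 0" "\<And>a b. c (a + b) = c a + c b" "\<And>a b. c (a * b) = c a * c b"
  shows "poly_subst c f (p * q) = poly_subst c f p * poly_subst c f q"
proof -
  let ?P = "Poly_Mapping.keys p" and ?Q = "Poly_Mapping.keys q"
  let ?p = "Poly_Mapping.lookup p" and ?q = "Poly_Mapping.lookup q"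
  have "p * q = (\<Sum>m\<in>?P. \<Sum>n\<in>?Q. Poly_Mapping.single m (?p m) * Poly_Mapping.single n (?q n))"
    by (subst qpoly_expansion[of p], subst qpoly_expansion[of q]) (rule sum_product)
  then have "p * q = (\<Sum>m\<in>?P. \<Sum>n\<in>?Q. Poly_Mapping.single (m + n) (?p m * ?q n))"
    by (simp add: mult_single)
  then have "poly_subst c f (p * q) =
      (\<Sum>m\<in>?P. \<Sum>n\<in>?Q. c (?p m * ?q n) * monom_subst f (m + n))"
    by (simp add: poly_subst_sum[where c = c, OF c(1,2)] poly_subst_single[where c = c, OF c(1)])
  also have "\<dots> = (\<Sum>m\<in>?P. \<Sum>n\<in>?Q. (c (?p m) * monom_subst f m) * (c (?q n) * monom_subst f n))"
    by (simp add: c(3) monom_subst_add mult_ac)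
  also have "\<dots> = poly_subst c f p * poly_subst c f q"
    unfolding poly_subst_def by (rule sum_product[symmetric])
  finally show ?thesis .
qed

lemma
  shows phi_Const: "phi (Const a) = Const a"
    and phi_1: "phi 1 = 1"
    and phi_Var: "phi (Var v) = phi_var v"
    and phi_add: "phi (p + q) = phi p + phi q"
    and phi_mult: "phi (p * q) = phi p * phi q"
proof -
  have c: "Const 0 = 0" "Const 1 = 1" "\<And>a b. Const (a + b) = Const a + Const b"
    "\<And>a b. Const (a * b) = Const a * Const b"
    by (simp_all add: Const_def single_add mult_single)
  show C: "phi (Const a) = Const a" for a
    unfolding phi_def by (rule poly_subst_Const) (simp add: c)
  show "phi 1 = 1"
    using C[of 1] by (simp add: Const_def)
  show "phi (Var v) = phi_var v"
    unfolding phi_def by (rule poly_subst_Var) (simp_all add: c)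
  show "phi (p + q) = phi p + phi q"
    unfolding phi_def by (rule poly_subst_add) (simp_all add: c)
  show "phi (p * q) = phi p * phi q"
    unfolding phi_def by (rule poly_subst_mult) (simp_all add: c)
qed

end

theory Submission
  imports Defs "HOL-Computational_Algebra.Fundamental_Theorem_Algebra"
begin

text \<open>
  Over \<open>\<complex>\<close>, put \<open>z\<^sub>i = x\<^sub>i + \<i> d\<^sub>i\<close> and \<open>w\<^sub>i = x\<^sub>i - \<i> d\<^sub>i\<close>. The eight explicit equations are
  symmetrizations of the cuboid equations \<open>x\<^sub>i\<^sup>2 + d\<^sub>i\<^sup>2 = L\<^sup>2 = x\<^sub>1\<^sup>2 + x\<^sub>2\<^sup>2 + x\<^sub>3\<^sup>2\<close>, the first of which
  read \<open>z\<^sub>i w\<^sub>i = L\<^sup>2\<close>. With \<open>P = E\<^sub>1\<^sub>0 + \<i> E\<^sub>0\<^sub>1\<close>, \<open>A = (E\<^sub>1\<^sub>0\<^sup>2 - E\<^sub>0\<^sub>1\<^sup>2 + L\<^sup>2) / 2 + \<i> E\<^sub>1\<^sub>1\<close> and their conjugates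
  \<open>Q\<close>, \<open>B\<close>, the hypothesis becomes \<open>A B = L\<^sup>2 P Q\<close>. For \<open>L \<noteq> 0\<close> this is exactly the
  condition under which the roots \<open>z\<^sub>i\<close> of \<open>X\<^sup>3 - P X\<^sup>2 + A X - L\<^sup>2 A / Q\<close> and \<open>w\<^sub>i = L\<^sup>2 / z\<^sub>i\<close> have elementary symmetric functions
  \<open>e\<^sub>1(z) = P\<close>, \<open>e\<^sub>2(z) = A\<close>, \<open>e\<^sub>1(w) = Q\<close>, \<open>e\<^sub>2(w) = B\<close>; for \<open>L = 0\<close>
  rationality forces \<open>A = B = 0\<close>, and \<open>z = (P, 0, 0)\<close>, \<open>w = (0, Q, 0)\<close> do. The resulting complex point \<open>(x, d)\<close> has
  rational multisymmetric functions with the prescribed \<open>E\<^sub>1\<^sub>0\<close>, \<open>E\<^sub>0\<^sub>1\<close>, \<open>E\<^sub>1\<^sub>1\<close>, and the kernel equations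
  hold because they hold on the image of every complex point. Homogeneity then
  allows clearing denominators.
\<close>

section \<open>Kernel equations\<close>

lemma poly_subst_phi:
  fixes g :: "xvar \<Rightarrow> 'a::field_char_0"
  assumes "\<And>v. of_rat (f v) = poly_subst of_rat g (phi_var v)"
  shows "poly_subst of_rat g (phi q) = of_rat (poly_eval f q)"
proof -
  define h where "h = poly_subst (of_rat :: rat \<Rightarrow> 'a) g"
  have h_mult: "h (p * q) = h p * h q" for p q
    unfolding h_def by (rule poly_subst_mult) (simp_all add: of_rat_add of_rat_mult)
  have h_Const: "h (Const a) = of_rat a" for a
    unfolding h_def by (rule poly_subst_Const) simp
  have h_1: "h 1 = 1"
    using h_Const[of 1] by (simp add: Const_def)
  have h_power: "h (p ^ n) = h p ^ n" for p n
    by (induction n) (simp_all add: h_1 h_mult)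
  have h_prod: "h (prod F S) = (\<Prod>x\<in>S. h (F x))" for F :: "evar \<Rightarrow> xvar qpoly" and S
    by (induction S rule: infinite_finite_induct) (simp_all add: h_1 h_mult)
  have h_sum: "h (sum F S) = (\<Sum>x\<in>S. h (F x))" for F :: "(evar \<Rightarrow>\<^sub>0 nat) \<Rightarrow> xvar qpoly" and S
    unfolding h_def by (rule poly_subst_sum) (simp_all add: of_rat_add)
  \<comment> \<open>Both \<open>h\<close> after \<open>phi\<close> and \<open>of_rat\<close> after
    \<open>poly_eval f\<close> are ring homomorphisms that agree on constants and variables;
    agreement spreads to monomials and then to sums of them.\<close>
  have "h (monom_subst phi_var m) = of_rat (monom_subst f m)" for m
    by (simp add: monom_subst_def h_prod h_power of_rat_prod of_rat_power
        assms[folded h_def])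
  then show ?thesis
    by (simp add: phi_def poly_subst_def[of _ _ q] h_sum h_mult h_Const of_rat_sum of_rat_mult
        flip: h_def)
qed

text \<open>The value of q at the integer point equals the value of \<open>phi q = 0\<close> at (x,
  d). The coordinates x, d may lie in an extension field: \<open>of_rat\<close> is injective there,
  so the vanishing descends to \<rat>.\<close>

lemma int_point_K:
  fixes x1 x2 x3 d1 d2 d3 :: "'a::field_char_0"
  assumes "of_int e10 = x1 + x2 + x3"
    and "of_int e20 = x1 * x2 + x2 * x3 + x3 * x1"
    and "of_int e30 = x1 * x2 * x3"
    and "of_int e01 = d1 + d2 + d3"
    and "of_int e02 = d1 * d2 + d2 * d3 + d3 * d1"
    and "of_int e03 = d1 * d2 * d3"
    and "of_int e21 = x1 * x2 * d3 + x2 * x3 * d1 + x3 * x1 * d2"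
    and "of_int e11 = x1 * d2 + d1 * x2 + x2 * d3 + d2 * x3 + x3 * d1 + d3 * x1"
    and "of_int e12 = x1 * d2 * d3 + x2 * d3 * d1 + x3 * d1 * d2"
    and "q \<in> K"
  shows "poly_eval (int_point e10 e20 e30 e01 e02 e03 e21 e11 e12 l) q = 0"
proof -
  let ?f = "int_point e10 e20 e30 e01 e02 e03 e21 e11 e12 l"
  let ?g = "\<lambda>v. case v of X1 \<Rightarrow> x1 | X2 \<Rightarrow> x2 | X3 \<Rightarrow> x3 | D1 \<Rightarrow> d1 | D2 \<Rightarrow> d2 | D3 \<Rightarrow> d3
                 | XL \<Rightarrow> of_int l"
  have "poly_subst of_rat ?g (p + q) = poly_subst of_rat ?g p + poly_subst of_rat ?g q"
    "poly_subst of_rat ?g (p * q) = poly_subst of_rat ?g p * poly_subst of_rat ?g q"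
    "poly_subst of_rat ?g (Var v) = ?g v" for p q v
    by (simp_all add: poly_subst_add poly_subst_mult poly_subst_Var of_rat_add of_rat_mult)
  then have "of_rat (?f v) = poly_subst of_rat ?g (phi_var v)" for v
    by (cases v) (simp_all add: assms)
  then have "of_rat (poly_eval ?f q) = poly_subst of_rat ?g (phi q)"
    using poly_subst_phi by metis
  then show ?thesis
    using \<open>q \<in> K\<close> by (simp add: K_def)
qed

section \<open>The eight explicit equations\<close>

lemma int_cuboid_equations:
  fixes x1 x2 x3 d1 d2 d3 :: "'a::field_char_0"
    and e10 e20 e30 e01 e02 e03 e21 e11 e12 l :: int
  assumes E: "of_int e10 = x1 + x2 + x3"
    "of_int e20 = x1 * x2 + x2 * x3 + x3 * x1"
    "of_int e30 = x1 * x2 * x3"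
    "of_int e01 = d1 + d2 + d3"
    "of_int e02 = d1 * d2 + d2 * d3 + d3 * d1"
    "of_int e03 = d1 * d2 * d3"
    "of_int e21 = x1 * x2 * d3 + x2 * x3 * d1 + x3 * x1 * d2"
    "of_int e11 = x1 * d2 + d1 * x2 + x2 * d3 + d2 * x3 + x3 * d1 + d3 * x1"
    "of_int e12 = x1 * d2 * d3 + x2 * d3 * d1 + x3 * d1 * d2"
    and l: "x1^2 + x2^2 + x3^2 = of_int l ^ 2"
    and d: "x1^2 + d1^2 = of_int l ^ 2" "x2^2 + d2^2 = of_int l ^ 2" "x3^2 + d3^2 = of_int l ^ 2"
  shows "e10^2 - 2 * e20 - l^2 = 0" (is "?f0 = 0")
    and "2 * e02 - 4 * e20 - e01^2 + 2 * e10^2 = 0" (is "?f1 = 0")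
    and "e10 * e11 - 3 * e03 - e21 + 3 * e01 * e02 - e20 * e01 - e01^3 = 0" (is "?f2 = 0")
    and "e01 * e11 - e12 - 3 * e30 + e10 * e02 + e20 * e10 - e01^2 * e10 = 0" (is "?f3 = 0")
    and "- (e10 * e21) - e01 * e12 - e01 * e30 - e01^3 * e10 + e01^2 * e11
        - e02 * e11 + e11 * e20 - e10 * e03 + 2 * e10 * e01 * e02 = 0" (is "?f4 = 0")
    and "4 * e01 * e10 * e11 - 3 * e01^2 * e10^2 + 2 * e10^2 * e02
        + 2 * e20 * e01^2 - 2 * e10 * e12 - 2 * e02 * e20 - 2 * e01 * e21
        - e11^2 - 12 * e10 * e30 + 6 * e20^2 = 0" (is "?f5 = 0")
    and "4 * e01 * e10 * e11 - 4 * e10^2 * e02 - 4 * e20 * e01^2 - 2 * e10 * e12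
        + 10 * e02 * e20 - 2 * e01 * e21 - e11^2 - 12 * e01 * e03 - 3 * e01^4
        - 6 * e02^2 + 12 * e01^2 * e02 = 0" (is "?f6 = 0")
    and "9 * e01 * e03 * e20 - 7 * e01^2 * e02 * e20 + 2 * e02 * e10 * e12
        - 2 * e01^2 * e10 * e12 + 3 * e03 * e10 * e11 + 4 * e01^3 * e10 * e11
        - 7 * e01 * e02 * e10 * e11 - 6 * e01 * e03 * e10^2
        + 8 * e01^2 * e02 * e10^2 + 3 * e01 * e11 * e30 - 2 * e01 * e20 * e21
        + e10 * e12 * e20 - e02 * e10^2 * e20 + e01 * e10 * e11 * e20
        + 9 * e02 * e10 * e30 - 2 * e02 * e20^2 + 2 * e01^2 * e20^2
        - e11^2 * e20 - 3 * e12 * e30 + e02 * e11^2 - e01^2 * e11^2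
        - 2 * e02^2 * e10^2 + 2 * e01^4 * e20 + 2 * e02^2 * e20 - 3 * e03 * e21
        - 2 * e01^3 * e21 + 5 * e01 * e02 * e21 - 6 * e01^2 * e10 * e30
        - 3 * e01^4 * e10^2 = 0" (is "?f7 = 0")
proof -
  \<comment> \<open>These are the face-diagonal equations of the cuboid. The first left-hand side is
    the space-diagonal equation; the others are sums of the \<open>p_i\<close> with weights 1, d_i,
    x_i, x_i d_i, 3 x_i^2, 3 d_i^2 and 3 x_i^2 d_i^2.\<close>
  define p1 p2 p3 where "p1 = x2^2 + x3^2 - d1^2" and "p2 = x3^2 + x1^2 - d2^2"
    and "p3 = x1^2 + x2^2 - d3^2"
  note p = p1_def p2_def p3_def
  have p0: "p1 = 0" "p2 = 0" "p3 = 0"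
    using l d unfolding p by algebra+
  have "(of_int ?f0 :: 'a) = x1^2 + x2^2 + x3^2 - of_int l ^ 2"
    by (simp add: E) algebra
  then show "?f0 = 0"
    using l by (simp del: of_int_diff of_int_power of_int_mult)
  have "(of_int ?f1 :: 'a) = p1 + p2 + p3"
    by (simp add: E p) algebra
  then show "?f1 = 0"
    unfolding p0 by (simp del: of_int_add of_int_diff of_int_power of_int_mult)
  have "(of_int ?f2 :: 'a) = d1 * p1 + d2 * p2 + d3 * p3"
    by (simp add: E p) algebra
  then show "?f2 = 0"
    unfolding p0 by (simp del: of_int_add of_int_diff of_int_power of_int_mult)
  have "(of_int ?f3 :: 'a) = x1 * p1 + x2 * p2 + x3 * p3"
    by (simp add: E p) algebra
  then show "?f3 = 0"
    unfolding p0 by (simp del: of_int_add of_int_diff of_int_power of_int_mult)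
  have "(of_int ?f4 :: 'a) = x1 * d1 * p1 + x2 * d2 * p2 + x3 * d3 * p3"
    by (simp add: E p) algebra
  then show "?f4 = 0"
    unfolding p0 by (simp del: of_int_add of_int_diff of_int_power of_int_mult of_int_minus)
  have "(of_int ?f5 :: 'a) = 3 * (x1^2 * p1 + x2^2 * p2 + x3^2 * p3)"
    by (simp add: E p) algebra
  then show "?f5 = 0"
    unfolding p0 by (simp del: of_int_add of_int_diff of_int_power of_int_mult)
  have "(of_int ?f6 :: 'a) = 3 * (d1^2 * p1 + d2^2 * p2 + d3^2 * p3)"
    by (simp add: E p) algebra
  then show "?f6 = 0"
    unfolding p0 by (simp del: of_int_add of_int_diff of_int_power of_int_mult)
  have "(of_int ?f7 :: 'a) = 3 * (x1^2 * d1^2 * p1 + x2^2 * d2^2 * p2 + x3^2 * d3^2 * p3)"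
    by (simp add: E p) algebra
  then show "?f7 = 0"
    unfolding p0 by (simp del: of_int_add of_int_diff of_int_power of_int_mult)
qed

section \<open>Construction of the complex point\<close>

lemma complex_cubic_roots:
  obtains z1 z2 z3 :: complex
  where "z1 + z2 + z3 = a" "z1 * z2 + z2 * z3 + z3 * z1 = b" "z1 * z2 * z3 = c"
proof -
  have "\<exists>z. poly [:- c, b, - a, 1:] z = 0"
    by (rule alg_closed_imp_poly_has_root) simp
  then obtain z where "poly [:- c, b, - a, 1:] z = 0" ..
  then have z: "z * (b - z * (a - z)) = c"
    by (simp add: algebra_simps)
  \<comment> \<open>The other two roots have sum \<open>a - z\<close> and product
    \<open>b - z * (a - z)\<close>; \<open>s\<close> is a square root of the discriminant of their
    quadratic.\<close>
  define s where "s = csqrt ((a - z)^2 - 4 * (b - z * (a - z)))"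
  have "s^2 = (a - z)^2 - 4 * (b - z * (a - z))"
    by (simp add: s_def)
  then have m: "(a - z + s) / 2 * ((a - z - s) / 2) = b - z * (a - z)"
    by (simp add: field_simps power2_eq_square)
  show thesis
  proof
    show "z + (a - z + s) / 2 + (a - z - s) / 2 = a"
      by (simp add: field_simps)
    show "z * ((a - z + s) / 2) + (a - z + s) / 2 * ((a - z - s) / 2) + (a - z - s) / 2 * z = b"
      unfolding m by (simp add: field_simps)
    show "z * ((a - z + s) / 2) * ((a - z - s) / 2) = c"
      unfolding mult.assoc m by (rule z)
  qed
qed

lemma complex_paired_roots:
  fixes P Q A B L :: complex
  assumes AB: "A * B = L^2 * P * Q" and PQ: "P * Q \<noteq> 0"
    and L0: "L = 0 \<Longrightarrow> A = 0 \<and> B = 0"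
  obtains z1 z2 z3 w1 w2 w3 where
    "z1 * w1 = L^2" "z2 * w2 = L^2" "z3 * w3 = L^2"
    "z1 + z2 + z3 = P" "z1 * z2 + z2 * z3 + z3 * z1 = A"
    "w1 + w2 + w3 = Q" "w1 * w2 + w2 * w3 + w3 * w1 = B"
proof (cases "L = 0")
  case True
  \<comment> \<open>The instantiation runs in the order z1, w1, z2, w2, z3, w3. The entries P and Q
    sit at different indices, so every z_i w_i is 0.\<close>
  show thesis
    by (rule that[of P 0 0 Q 0 0]) (use True L0 in simp_all)
next
  case False
  obtain z1 z2 z3 where z: "z1 + z2 + z3 = P" "z1 * z2 + z2 * z3 + z3 * z1 = A"
    "z1 * z2 * z3 = L^2 * A / Q"
    by (rule complex_cubic_roots)
  have nz: "A \<noteq> 0" "P \<noteq> 0" "Q \<noteq> 0"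
    using AB PQ False by auto
  then have T: "z1 * z2 * z3 \<noteq> 0"
    using z(3) False by simp
  then have zi: "z1 \<noteq> 0" "z2 \<noteq> 0" "z3 \<noteq> 0"
    by auto
  show thesis
  proof (rule that[of z1 "L^2 / z1" z2 "L^2 / z2" z3 "L^2 / z3"])
    \<comment> \<open>Multiplying by e_3(z) = L^2 A / Q turns e_1(w) into L^2 e_2(z), and below
      e_2(w) into L^4 e_1(z); the nonzero factor L^2 A then cancels.\<close>
    have "(L^2 / z1 + L^2 / z2 + L^2 / z3) * (z1 * z2 * z3) = L^2 * (z1 * z2 + z2 * z3 + z3 * z1)"
      using zi by (simp add: field_simps)
    then have "(L^2 / z1 + L^2 / z2 + L^2 / z3) * (L^2 * A) = Q * (L^2 * A)"
      using nz unfolding z by (simp add: divide_eq_eq mult.commute)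
    then show "L^2 / z1 + L^2 / z2 + L^2 / z3 = Q"
      using nz False by simp
    have "(L^2 / z1 * (L^2 / z2) + L^2 / z2 * (L^2 / z3) + L^2 / z3 * (L^2 / z1)) * (z1 * z2 * z3)
        = L^4 * (z1 + z2 + z3)"
      using zi by (simp add: field_simps power_def)
    then have "(L^2 / z1 * (L^2 / z2) + L^2 / z2 * (L^2 / z3) + L^2 / z3 * (L^2 / z1)) * (L^2 * A)
        = L^4 * P * Q"
      using nz unfolding z by (simp add: divide_eq_eq)
    also have "\<dots> = B * (L^2 * A)"
      using AB by algebra
    finally show "L^2 / z1 * (L^2 / z2) + L^2 / z2 * (L^2 / z3) + L^2 / z3 * (L^2 / z1) = B"
      using nz False by simp
  qed (use zi z in simp_all)
qed

text \<open>Each product z_i w_i inside the expansion is replaced by m. No division by z_i occurs,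
  so the case m = 0 is covered too.\<close>

lemma paired_roots_product:
  fixes z1 z2 z3 w1 w2 w3 :: "'a::comm_ring_1"
  assumes "z1 * w1 = m" "z2 * w2 = m" "z3 * w3 = m"
  shows "z1 * z2 * z3 * (w1 + w2 + w3) = m * (z1 * z2 + z2 * z3 + z3 * z1)"
    and "z1 * z2 * w3 + z2 * z3 * w1 + z3 * z1 * w2 =
      (z1 * z2 + z2 * z3 + z3 * z1) * (w1 + w2 + w3) - 2 * m * (z1 + z2 + z3)"
proof -
  have "z1 * z2 * z3 * (w1 + w2 + w3) = z2 * z3 * (z1 * w1) + z1 * z3 * (z2 * w2) + z1 * z2 * (z3 * w3)"
    by (simp add: algebra_simps)
  then show "z1 * z2 * z3 * (w1 + w2 + w3) = m * (z1 * z2 + z2 * z3 + z3 * z1)"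
    unfolding assms by (simp add: algebra_simps)
  have "z1 * z2 * w3 + z2 * z3 * w1 + z3 * z1 * w2 =
      (z1 * z2 + z2 * z3 + z3 * z1) * (w1 + w2 + w3)
      - (z1 * w1) * (z2 + z3) - (z2 * w2) * (z1 + z3) - (z3 * w3) * (z1 + z2)"
    by (simp add: algebra_simps)
  then show "z1 * z2 * w3 + z2 * z3 * w1 + z3 * z1 * w2 =
      (z1 * z2 + z2 * z3 + z3 * z1) * (w1 + w2 + w3) - 2 * m * (z1 + z2 + z3)"
    unfolding assms by (simp add: algebra_simps)
qed

text \<open>Up to constants these are x1 x2 x3 and d1 d2 d3, whose rationality has to be shown. They
  expand into e_3(z), e_3(w) and mixed sums, all determined by e_1 and e_2; the results are
  symmetric resp. antisymmetric under exchanging (P, A) with (Q, B).\<close>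

lemma paired_roots_triple_product:
  fixes z1 z2 z3 w1 w2 w3 :: "'a::field"
  assumes m: "z1 * w1 = m" "z2 * w2 = m" "z3 * w3 = m"
    and z: "z1 + z2 + z3 = P" "z1 * z2 + z2 * z3 + z3 * z1 = A"
    and w: "w1 + w2 + w3 = Q" "w1 * w2 + w2 * w3 + w3 * w1 = B"
    and PQ: "P * Q \<noteq> 0"
  shows "(z1 + w1) * (z2 + w2) * (z3 + w3) =
      m * (A * P + B * Q) / (P * Q) + (A * Q + B * P) - 2 * m * (P + Q)"
    and "(z1 - w1) * (z2 - w2) * (z3 - w3) =
      m * (A * P - B * Q) / (P * Q) - (A * Q - B * P) + 2 * m * (P - Q)"
proof -
  have m': "w1 * z1 = m" "w2 * z2 = m" "w3 * z3 = m"
    using m by (simp_all add: mult.commute)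
  note zw = paired_roots_product[OF m, unfolded z w] and wz = paired_roots_product[OF m', unfolded z w]
  have T: "z1 * z2 * z3 = m * A / Q" "w1 * w2 * w3 = m * B / P"
    using zw(1) wz(1) PQ by (simp_all add: field_simps)
  have "(z1 + w1) * (z2 + w2) * (z3 + w3) = z1 * z2 * z3 + w1 * w2 * w3
      + (z1 * z2 * w3 + z2 * z3 * w1 + z3 * z1 * w2) + (w1 * w2 * z3 + w2 * w3 * z1 + w3 * w1 * z2)"
    by (simp add: algebra_simps)
  then show "(z1 + w1) * (z2 + w2) * (z3 + w3) =
      m * (A * P + B * Q) / (P * Q) + (A * Q + B * P) - 2 * m * (P + Q)"
    unfolding zw(2) wz(2) T using PQ by (simp add: field_simps)
  have "(z1 - w1) * (z2 - w2) * (z3 - w3) = z1 * z2 * z3 - w1 * w2 * w3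
      - (z1 * z2 * w3 + z2 * z3 * w1 + z3 * z1 * w2) + (w1 * w2 * z3 + w2 * w3 * z1 + w3 * w1 * z2)"
    by (simp add: algebra_simps)
  then show "(z1 - w1) * (z2 - w2) * (z3 - w3) =
      m * (A * P - B * Q) / (P * Q) - (A * Q - B * P) + 2 * m * (P - Q)"
    unfolding zw(2) wz(2) T using PQ by (simp add: field_simps)
qed

lemma complex_cuboid_point:
  fixes e10 e01 e11 l :: rat
  assumes hyp: "4 * e11^2 + e10^4 + e01^4 - 2 * e10^2 * e01^2 - 2 * l^2 * e10^2
        - 6 * e01^2 * l^2 + l^4 = 0"
    and N: "e10^2 + e01^2 \<noteq> 0"
  obtains x1 x2 x3 d1 d2 d3 :: complex where
    "x1 + x2 + x3 = of_rat e10" "d1 + d2 + d3 = of_rat e01"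
    "x1 * d2 + d1 * x2 + x2 * d3 + d2 * x3 + x3 * d1 + d3 * x1 = of_rat e11"
    "x1^2 + x2^2 + x3^2 = of_rat l ^ 2"
    "x1^2 + d1^2 = of_rat l ^ 2" "x2^2 + d2^2 = of_rat l ^ 2" "x3^2 + d3^2 = of_rat l ^ 2"
    "x1 * x2 * x3 \<in> \<rat>" "d1 * d2 * d3 \<in> \<rat>"
proof -
  define x y u L where "x = (of_rat e10 :: complex)" and "y = (of_rat e01 :: complex)"
    and "u = (of_rat e11 :: complex)" and "L = (of_rat l :: complex)"
  \<comment> \<open>e_2(z) is E20 - E02 + \<i> E11, and the cuboid equations force E20 = (x^2 - L^2)
    / 2 and E02 = (y^2 - 2 L^2) / 2, so E20 - E02 = a / 2.\<close>
  define a where "a = x^2 - y^2 + L^2"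
  define P Q A B where "P = x + \<i> * y" and "Q = x - \<i> * y"
    and "A = a / 2 + \<i> * u" and "B = a / 2 - \<i> * u"
  have rat [simp]: "x \<in> \<rat>" "y \<in> \<rat>" "u \<in> \<rat>" "L \<in> \<rat>" "a \<in> \<rat>"
    by (simp_all add: x_def y_def u_def L_def a_def)
  have ii: "\<i> * \<i> = -1"
    by simp
  have PQ: "P * Q = x^2 + y^2"
    using ii unfolding P_def Q_def by algebra
  have "x^2 + y^2 = of_rat (e10^2 + e01^2)"
    by (simp add: x_def y_def of_rat_add of_rat_power)
  then have PQ0: "P * Q \<noteq> 0"
    using N PQ by (simp del: of_rat_add of_rat_power)
  have h: "4 * u^2 + x^4 + y^4 - 2 * x^2 * y^2 - 2 * L^2 * x^2 - 6 * y^2 * L^2 + L^4 = 0"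
    using arg_cong[OF hyp, of "of_rat :: rat \<Rightarrow> complex"]
    by (simp add: x_def y_def u_def L_def of_rat_add of_rat_diff of_rat_mult of_rat_power)
  have "4 * (A * B) = a^2 + 4 * u^2"
    unfolding A_def B_def by (simp add: field_simps power2_eq_square)
  also have "\<dots> = 4 * (L^2 * (x^2 + y^2))"
    using h unfolding a_def by algebra
  finally have AB: "A * B = L^2 * P * Q"
    by (simp add: PQ mult.assoc)
  have L0: "A = 0 \<and> B = 0" if "L = 0"
  proof -
    have "l = 0"
      using that by (simp add: L_def)
    \<comment> \<open>For l = 0 the hypothesis is a vanishing sum of two rational squares, so the
      order on \<rat> makes both vanish.\<close>
    then have "(2 * e11)^2 + (e10^2 - e01^2)^2 = 0"
      using hyp by (simp add: algebra_simps power4_eq_xxxx power2_eq_square)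
    then have e: "e11 = 0 \<and> e10^2 - e01^2 = 0"
      by (simp only: sum_power2_eq_zero_iff) simp
    have "a = of_rat (e10^2 - e01^2)"
      using that by (simp add: a_def x_def y_def of_rat_diff of_rat_power)
    with e show ?thesis
      by (simp add: u_def A_def B_def)
  qed
  obtain z1 z2 z3 w1 w2 w3 where
    m: "z1 * w1 = L^2" "z2 * w2 = L^2" "z3 * w3 = L^2" and
    z: "z1 + z2 + z3 = P" "z1 * z2 + z2 * z3 + z3 * z1 = A" and
    w: "w1 + w2 + w3 = Q" "w1 * w2 + w2 * w3 + w3 * w1 = B"
    by (rule complex_paired_roots[OF AB PQ0 L0])
  note T = paired_roots_triple_product[OF m z w PQ0]
  \<comment> \<open>Inverse of z = x + \<i> d, w = x - \<i> d.\<close>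
  define X D :: "complex \<Rightarrow> complex \<Rightarrow> complex"
    where "X = (\<lambda>z w. (z + w) / 2)" and "D = (\<lambda>z w. - \<i> * (z - w) / 2)"
  have circle: "X z w ^ 2 + D z w ^ 2 = z * w" for z w
    unfolding X_def D_def by (simp add: field_simps power2_eq_square)
  have pz: "z1^2 + z2^2 + z3^2 = P^2 - 2 * A" and pw: "w1^2 + w2^2 + w3^2 = Q^2 - 2 * B"
    unfolding z[symmetric] w[symmetric] by algebra+
  have sum_X: "X z1 w1 + X z2 w2 + X z3 w3 = x"
  proof -
    have "X z1 w1 + X z2 w2 + X z3 w3 = ((z1 + z2 + z3) + (w1 + w2 + w3)) / 2"
      by (simp add: X_def field_simps)
    then show ?thesis
      unfolding z w by (simp add: P_def Q_def)
  qed
  have sum_D: "D z1 w1 + D z2 w2 + D z3 w3 = y"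
  proof -
    have "D z1 w1 + D z2 w2 + D z3 w3 = - \<i> * ((z1 + z2 + z3) - (w1 + w2 + w3)) / 2"
      by (simp add: D_def field_simps)
    then show ?thesis
      unfolding z w by (simp add: P_def Q_def)
  qed
  \<comment> \<open>E11 is e_1(x) e_1(d) minus this diagonal sum, which is computed from z^2 - w^2 =
    4 \<i> x d.\<close>
  have sum_XD: "X z1 w1 * D z1 w1 + X z2 w2 * D z2 w2 + X z3 w3 * D z3 w3 = x * y - u"
  proof -
    have "X z1 w1 * D z1 w1 + X z2 w2 * D z2 w2 + X z3 w3 * D z3 w3
        = - \<i> * ((z1^2 + z2^2 + z3^2) - (w1^2 + w2^2 + w3^2)) / 4"
      by (simp add: X_def D_def field_simps power2_eq_square)
    also have "\<dots> = x * y - u"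
      unfolding pz pw P_def Q_def A_def B_def by (simp add: field_simps power2_eq_square)
    finally show ?thesis .
  qed
  have sum_X2: "X z1 w1 ^ 2 + X z2 w2 ^ 2 + X z3 w3 ^ 2 = L^2"
  proof -
    have "X z1 w1 ^ 2 + X z2 w2 ^ 2 + X z3 w3 ^ 2
        = ((z1^2 + z2^2 + z3^2) + (w1^2 + w2^2 + w3^2) + 2 * (z1 * w1 + z2 * w2 + z3 * w3)) / 4"
      by (simp add: X_def field_simps power2_eq_square)
    also have "\<dots> = L^2"
      unfolding pz pw m P_def Q_def A_def B_def a_def by (simp add: field_simps power2_eq_square)
    finally show ?thesis .
  qed
  \<comment> \<open>Symmetric combinations are rational and antisymmetric ones are \<i> times a
    rational; the factor (-\<i>)^3 = \<i> in the product of the \<open>D\<close> terms compensates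
    the latter.\<close>
  have Re_Im: "A * P + B * Q = a * x - 2 * u * y" "A * P - B * Q = \<i> * (a * y + 2 * u * x)"
    "A * Q + B * P = a * x + 2 * u * y" "A * Q - B * P = \<i> * (2 * u * x - a * y)"
    "P + Q = 2 * x" "P - Q = \<i> * (2 * y)"
    unfolding P_def Q_def A_def B_def by (simp_all add: field_simps)
  have prod_X: "X z1 w1 * X z2 w2 * X z3 w3 \<in> \<rat>"
  proof -
    have "X z1 w1 * X z2 w2 * X z3 w3 = (z1 + w1) * (z2 + w2) * (z3 + w3) / 8"
      by (simp add: X_def)
    also have "\<dots> \<in> \<rat>"
      unfolding T Re_Im PQ by simp
    finally show ?thesis .
  qed
  have prod_D: "D z1 w1 * D z2 w2 * D z3 w3 \<in> \<rat>"
  proof -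
    have i_factor: "\<i> * (m * (\<i> * c) / n - \<i> * d + 2 * m * (\<i> * e)) / 8
        = - (m * c / n - d + 2 * m * e) / 8" for m c n d e
      by (simp add: algebra_simps)
    have "D z1 w1 * D z2 w2 * D z3 w3 = \<i> * ((z1 - w1) * (z2 - w2) * (z3 - w3)) / 8"
      by (simp add: D_def mult_ac)
    also have "\<dots> = - (L^2 * (a * y + 2 * u * x) / (x^2 + y^2) - (2 * u * x - a * y)
        + 2 * L^2 * (2 * y)) / 8"
      unfolding T Re_Im PQ by (rule i_factor)
    also have "\<dots> \<in> \<rat>"
      by simp
    finally show ?thesis .
  qed
  show thesis
  proof (rule that)
    have "X z1 w1 * D z2 w2 + D z1 w1 * X z2 w2 + X z2 w2 * D z3 w3 + D z2 w2 * X z3 w3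
        + X z3 w3 * D z1 w1 + D z3 w3 * X z1 w1
      = (X z1 w1 + X z2 w2 + X z3 w3) * (D z1 w1 + D z2 w2 + D z3 w3)
        - (X z1 w1 * D z1 w1 + X z2 w2 * D z2 w2 + X z3 w3 * D z3 w3)"
      by (simp add: algebra_simps)
    also have "\<dots> = of_rat e11"
      unfolding sum_X sum_D sum_XD by (simp add: u_def)
    finally show "X z1 w1 * D z2 w2 + D z1 w1 * X z2 w2 + X z2 w2 * D z3 w3 + D z2 w2 * X z3 w3
        + X z3 w3 * D z1 w1 + D z3 w3 * X z1 w1 = of_rat e11" .
  qed (use sum_X sum_D sum_X2 prod_X prod_D circle m in \<open>simp_all add: x_def y_def L_def\<close>)
qed

section \<open>Clearing denominators\<close>

lemma common_denominator:
  assumes "finite S" "S \<subseteq> \<rat>"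
  obtains k :: int where "k > 0" "\<And>r::'a::field_char_0. r \<in> S \<Longrightarrow> of_int k * r \<in> \<int>"
proof -
  have "\<exists>k>0. \<forall>r\<in>S. of_int k * r \<in> \<int>"
    using assms
  proof (induction S)
    case empty
    show ?case
      by (auto intro: exI[of _ 1])
  next
    case (insert s S)
    then obtain k where k: "k > 0" "\<forall>r\<in>S. of_int k * r \<in> \<int>"
      by auto
    from insert.prems have "s \<in> \<rat>"
      by simp
    then obtain a b :: int where ab: "b > 0" "s = of_int a / of_int b"
      by (rule Rats_cases')
    have "of_int (b * k) * s = of_int (k * a)"
      using ab by simp
    then have "of_int (b * k) * s \<in> \<int>"
      by (metis Ints_of_int)
    moreover have "of_int (b * k) * r \<in> \<int>" if "r \<in> S" for r
      using k(2) that by (simp add: mult.assoc Ints_mult)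
    ultimately show ?case
      using k(1) ab(1) by (intro exI[of _ "b * k"]) auto
  qed
  then show thesis
    using that by blast
qed

theorem theorem5p2:
  fixes e10 e01 e11 l :: rat
  assumes "4 * e11^2 + e10^4 + e01^4 - 2 * e10^2 * e01^2 - 2 * l^2 * e10^2
        - 6 * e01^2 * l^2 + l^4 = 0"
    and "e10^2 + e01^2 \<noteq> 0"
  shows "\<exists>(\<alpha>::int) (e10'::int) (e20'::int) (e30'::int) (e01'::int) (e02'::int)
       (e03'::int) (e21'::int) (e11'::int) (e12'::int) (l'::int).
      \<alpha> > 0
      \<and> of_int e10' = of_int \<alpha> * e10
      \<and> of_int e01' = of_int \<alpha> * e01
      \<and> of_int e11' = of_int (\<alpha>^2) * e11
      \<and> of_int l' = of_int \<alpha> * l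
      \<and> e10'^2 - 2 * e20' - l'^2 = 0
      \<and> 2 * e02' - 4 * e20' - e01'^2 + 2 * e10'^2 = 0
      \<and> e10' * e11' - 3 * e03' - e21' + 3 * e01' * e02' - e20' * e01' - e01'^3 = 0
      \<and> e01' * e11' - e12' - 3 * e30' + e10' * e02' + e20' * e10' - e01'^2 * e10' = 0
      \<and> - (e10' * e21') - e01' * e12' - e01' * e30' - e01'^3 * e10' + e01'^2 * e11'
        - e02' * e11' + e11' * e20' - e10' * e03' + 2 * e10' * e01' * e02' = 0
      \<and> 4 * e01' * e10' * e11' - 3 * e01'^2 * e10'^2 + 2 * e10'^2 * e02'
        + 2 * e20' * e01'^2 - 2 * e10' * e12' - 2 * e02' * e20' - 2 * e01' * e21'
        - e11'^2 - 12 * e10' * e30' + 6 * e20'^2 = 0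
      \<and> 4 * e01' * e10' * e11' - 4 * e10'^2 * e02' - 4 * e20' * e01'^2 - 2 * e10' * e12'
        + 10 * e02' * e20' - 2 * e01' * e21' - e11'^2 - 12 * e01' * e03' - 3 * e01'^4
        - 6 * e02'^2 + 12 * e01'^2 * e02' = 0
      \<and> 9 * e01' * e03' * e20' - 7 * e01'^2 * e02' * e20' + 2 * e02' * e10' * e12'
        - 2 * e01'^2 * e10' * e12' + 3 * e03' * e10' * e11' + 4 * e01'^3 * e10' * e11'
        - 7 * e01' * e02' * e10' * e11' - 6 * e01' * e03' * e10'^2
        + 8 * e01'^2 * e02' * e10'^2 + 3 * e01' * e11' * e30' - 2 * e01' * e20' * e21'
        + e10' * e12' * e20' - e02' * e10'^2 * e20' + e01' * e10' * e11' * e20'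
        + 9 * e02' * e10' * e30' - 2 * e02' * e20'^2 + 2 * e01'^2 * e20'^2
        - e11'^2 * e20' - 3 * e12' * e30' + e02' * e11'^2 - e01'^2 * e11'^2
        - 2 * e02'^2 * e10'^2 + 2 * e01'^4 * e20' + 2 * e02'^2 * e20' - 3 * e03' * e21'
        - 2 * e01'^3 * e21' + 5 * e01' * e02' * e21' - 6 * e01'^2 * e10' * e30'
        - 3 * e01'^4 * e10'^2 = 0
      \<and> (\<forall>q\<in>K. poly_eval (int_point e10' e20' e30' e01' e02' e03' e21' e11' e12' l') q = 0)"
proof -
  obtain x1 x2 x3 d1 d2 d3 :: complex where
    E: "x1 + x2 + x3 = of_rat e10" "d1 + d2 + d3 = of_rat e01"
    "x1 * d2 + d1 * x2 + x2 * d3 + d2 * x3 + x3 * d1 + d3 * x1 = of_rat e11"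
    and l: "x1^2 + x2^2 + x3^2 = of_rat l ^ 2"
    and d: "x1^2 + d1^2 = of_rat l ^ 2" "x2^2 + d2^2 = of_rat l ^ 2" "x3^2 + d3^2 = of_rat l ^ 2"
    and R: "x1 * x2 * x3 \<in> \<rat>" "d1 * d2 * d3 \<in> \<rat>"
    by (rule complex_cuboid_point[OF assms])
  define s20 s02 s21 s12 where "s20 = x1 * x2 + x2 * x3 + x3 * x1"
    and "s02 = d1 * d2 + d2 * d3 + d3 * d1"
    and "s21 = x1 * x2 * d3 + x2 * x3 * d1 + x3 * x1 * d2"
    and "s12 = x1 * d2 * d3 + x2 * d3 * d1 + x3 * d1 * d2"
  note s = s20_def s02_def s21_def s12_def
  \<comment> \<open>The first four explicit equations determine these four functions rationally from
    the given values and the two triple products.\<close>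
  have "2 * s20 = of_rat e10 ^ 2 - of_rat l ^ 2"
    unfolding s E[symmetric] l[symmetric] by algebra
  then have s20: "s20 = (of_rat e10 ^ 2 - of_rat l ^ 2) / 2"
    by (simp add: eq_divide_eq mult.commute)
  have sum_d2: "d1^2 + d2^2 + d3^2 = 2 * of_rat l ^ 2"
    using l d by algebra
  have "2 * s02 = of_rat e01 ^ 2 - 2 * of_rat l ^ 2"
    unfolding s E[symmetric] sum_d2[symmetric] by algebra
  then have s02: "s02 = (of_rat e01 ^ 2 - 2 * of_rat l ^ 2) / 2"
    by (simp add: eq_divide_eq mult.commute)
  have p: "d1^2 = x2^2 + x3^2" "d2^2 = x3^2 + x1^2" "d3^2 = x1^2 + x2^2"
    using l d by algebra+
  have "s21 = of_rat e10 * of_rat e11 - 3 * (d1 * d2 * d3) + 3 * of_rat e01 * s02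
      - s20 * of_rat e01 - of_rat e01 ^ 3
      - d1 * (x2^2 + x3^2 - d1^2) - d2 * (x3^2 + x1^2 - d2^2) - d3 * (x1^2 + x2^2 - d3^2)"
    unfolding s E[symmetric] by algebra
  then have s21: "s21 = of_rat e10 * of_rat e11 - 3 * (d1 * d2 * d3) + 3 * of_rat e01 * s02
      - s20 * of_rat e01 - of_rat e01 ^ 3"
    by (simp add: p)
  have "s12 = of_rat e01 * of_rat e11 - 3 * (x1 * x2 * x3) + of_rat e10 * s02
      + s20 * of_rat e10 - of_rat e01 ^ 2 * of_rat e10
      - x1 * (x2^2 + x3^2 - d1^2) - x2 * (x3^2 + x1^2 - d2^2) - x3 * (x1^2 + x2^2 - d3^2)"
    unfolding s E[symmetric] by algebra
  then have s12: "s12 = of_rat e01 * of_rat e11 - 3 * (x1 * x2 * x3) + of_rat e10 * s02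
      + s20 * of_rat e10 - of_rat e01 ^ 2 * of_rat e10"
    by (simp add: p)
  have Rs: "s20 \<in> \<rat>" "s02 \<in> \<rat>" "s21 \<in> \<rat>" "s12 \<in> \<rat>"
    using R by (simp_all add: s21 s12 s20 s02)
  define S where "S = {of_rat e10, s20, x1 * x2 * x3, of_rat e01, s02, d1 * d2 * d3, s21,
    of_rat e11, s12, of_rat l}"
  have "finite S" "S \<subseteq> \<rat>"
    using R Rs by (simp_all add: S_def)
  then obtain k :: int where k: "k > 0" and kS: "\<And>r. r \<in> S \<Longrightarrow> of_int k * r \<in> \<int>"
    by (rule common_denominator) blast
  let ?k = "of_int k :: complex"
  \<comment> \<open>One factor \<open>k\<close> makes r integral and further factors keep it so. The
    exponent \<open>Suc n\<close> is the degree of the function: i + j for E_ij, 1 for L.\<close>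
  have clear: "\<exists>e::int. of_int e = ?k ^ Suc n * r" if "r \<in> S" for n r
  proof -
    have "?k ^ n * (?k * r) \<in> \<int>"
      by (rule Ints_mult[OF _ kS[OF that]]) simp
    then show ?thesis
      by (metis Ints_cases mult.assoc power_Suc2)
  qed
  obtain e10' e20' e30' e01' e02' e03' e21' e11' e12' l' :: int where e':
    "of_int e10' = ?k ^ Suc 0 * of_rat e10" "of_int e20' = ?k ^ Suc 1 * s20"
    "of_int e30' = ?k ^ Suc 2 * (x1 * x2 * x3)"
    "of_int e01' = ?k ^ Suc 0 * of_rat e01" "of_int e02' = ?k ^ Suc 1 * s02"
    "of_int e03' = ?k ^ Suc 2 * (d1 * d2 * d3)"
    "of_int e21' = ?k ^ Suc 2 * s21" "of_int e11' = ?k ^ Suc 1 * of_rat e11"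
    "of_int e12' = ?k ^ Suc 2 * s12" "of_int l' = ?k ^ Suc 0 * of_rat l"
    using clear unfolding S_def by (metis insertCI)
  have pow: "?k ^ Suc 0 = ?k" "?k ^ Suc 1 = ?k * ?k" "?k ^ Suc 2 = ?k * ?k * ?k"
    by (simp_all add: power2_eq_square power3_eq_cube)
  \<comment> \<open>By homogeneity the integer point comes from the scaled complex point (k x, k d),
    which satisfies the cuboid equations for l' = k l.\<close>
  have pt: "of_int e10' = ?k * x1 + ?k * x2 + ?k * x3"
    "of_int e20' = ?k * x1 * (?k * x2) + ?k * x2 * (?k * x3) + ?k * x3 * (?k * x1)"
    "of_int e30' = ?k * x1 * (?k * x2) * (?k * x3)"
    "of_int e01' = ?k * d1 + ?k * d2 + ?k * d3"
    "of_int e02' = ?k * d1 * (?k * d2) + ?k * d2 * (?k * d3) + ?k * d3 * (?k * d1)"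
    "of_int e03' = ?k * d1 * (?k * d2) * (?k * d3)"
    "of_int e21' = ?k * x1 * (?k * x2) * (?k * d3) + ?k * x2 * (?k * x3) * (?k * d1)
      + ?k * x3 * (?k * x1) * (?k * d2)"
    "of_int e11' = ?k * x1 * (?k * d2) + ?k * d1 * (?k * x2) + ?k * x2 * (?k * d3)
      + ?k * d2 * (?k * x3) + ?k * x3 * (?k * d1) + ?k * d3 * (?k * x1)"
    "of_int e12' = ?k * x1 * (?k * d2) * (?k * d3) + ?k * x2 * (?k * d3) * (?k * d1)
      + ?k * x3 * (?k * d1) * (?k * d2)"
    unfolding e' pow s E[symmetric] by (simp_all add: algebra_simps)
  have l': "(?k * x1)^2 + (?k * x2)^2 + (?k * x3)^2 = of_int l' ^ 2"
    "(?k * x1)^2 + (?k * d1)^2 = of_int l' ^ 2" "(?k * x2)^2 + (?k * d2)^2 = of_int l' ^ 2"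
    "(?k * x3)^2 + (?k * d3)^2 = of_int l' ^ 2"
    using l d unfolding e' pow by (simp_all add: power_mult_distrib flip: distrib_left)
  have rat_eq: "of_int e = of_int n * r" if "of_int e = of_int n * (of_rat r :: complex)"
    for e n :: int and r
  proof -
    from that have "(of_rat (of_int e) :: complex) = of_rat (of_int n * r)"
      by (simp add: of_rat_mult)
    then show ?thesis
      by (simp only: of_rat_eq_iff)
  qed
  have "of_int e10' = of_int k * e10" "of_int e01' = of_int k * e01"
    "of_int e11' = of_int (k^2) * e11" "of_int l' = of_int k * l"
    by (rule rat_eq; simp add: e' power2_eq_square)+
  with k show ?thesis
    using int_cuboid_equations[OF pt l'] int_point_K[OF pt] by blast
qed

end
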